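(* Let $n\ge 3$ and $d\ge 1$ be integers and let $\overline{\sigma}=\{\sigma_1,\ldots,\sigma_n\}$ be a collection of $n$ integer partitions of $d$. Then the space $\mathcal{H}(\overline{\sigma})$ (defined in the context) is connected.
   Context: **Graphs.** A graph is a pair $(V,E)$ with $V$ a finite set and $E$ a set of unordered pairs of elements of $V$. A tree is a connected graph without circuits. A leaf is a vertex of degree $1$; other vertices are internal. An edge containing a leaf is unbounded; other edges are bounded. A graph is trivalent if all vertices have degree $1$ or $3$. A trivalent tree with $n\ge 3$ leaves has $m=n-3$ bounded edges. An isomorphism of graphs is a bijection $F_V$ of vertices inducing a bijection $F_E$ of edges; the topological type of a graph is its isomorphism class. The degeneration of $G$ by a bounded edge $e$ is the graph obtained by contracting $e$ to a point (identifying its endpoints and deleting $e$). **Class algebra.** For an integer partition $\mu$ of $d$, $K_\mu\in Z(\mathbb{R}[S_d])$ is the sum of all permutations in $S_d$ of cycle-type $\mu$. The function $\mathrm{tr}:Z(\mathbb{R}[S_d])\to\mathbb{R}$ is $\mathrm{tr}(\sum_g c_g g)=c_e$, the coefficient of the identity. **Labelled trees.** Let $G$ be a topological type of trivalent trees with $n$ leaves, with its unbounded edges (equivalently its leaves) labelled by the distinct elements of $\overline{\lambda}=\{\lambda_1,\ldots,\lambda_n\}$ and its bounded edges labelled by the distinct elements of $\overline{E}=\{e_1,\ldots,e_m\}$. Assign $\sigma_i$ to $\lambda_i$, and let $\overline{\nu}=\{\nu_1,\ldots,\nu_m\}$ be a choice of an integer partition $\nu_i$ of $d$ for each $e_i$.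 This data is denoted $G(\overline{\sigma},\overline{\nu})$. It is acceptable if for every internal vertex $v$, $\mathrm{tr}(K_{\mu_1}K_{\mu_2}K_{\mu_3})\ne 0$, where $\mu_1,\mu_2,\mu_3$ are the partitions assigned to the three edges at $v$. For $p=(p_1,\ldots,p_m)\in\mathbb{R}^m_{\ge 0}$, $G(\overline{\lambda},\overline{E})(p)$ is the labelled metric graph obtained from $G$ by degenerating every $e_i$ with $p_i=0$ and giving length $p_i$ to each $e_i$ with $p_i>0$; the labels of the surviving edges are kept. **The space.** $D(\overline{\sigma})$ is the disjoint union of copies $D(\overline{\sigma})_{G(\overline{\sigma},\overline{\nu})}$ of $\mathbb{R}^m_{\ge 0}$ (with the Euclidean topology), indexed by the possible choices of acceptable $G(\overline{\sigma},\overline{\nu})$ ($\overline{\sigma}$ is fixed; the labelled trivalent tree and $\overline{\nu}$ vary). $\mathcal{H}(\overline{\sigma})$ is the topological space formed from $D(\overline{\sigma})$ by identifying $p\in D(\overline{\sigma})_{G(\overline{\sigma},\overline{\nu})}$ and $q\in D(\overline{\sigma})_{G'(\overline{\sigma},\overline{\nu}')}$ exactly when there is an isomorphism of metric graphs (a graph isomorphism preserving lengths of bounded edges) $F:G(\overline{\lambda},\overline{E})(p)\to G'(\overline{\lambda},\overline{E})(q)$ such that $F_E(\lambda_i)=\lambda_i$ for all $i$, and $F_E(e_i)=e_j$ implies $\nu_i=\nu'_j$. *)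

theory Defs
  imports "HOL-Analysis.Analysis" "HOL-Algebra.Sym_Groups" "HOL-Combinatorics.Orbits"
    "HOL-Library.Multiset"
begin

section \<open>Graphs\<close>

type_synonym 'a graph = "'a set \<times> 'a set set"

abbreviation verts :: "'a graph \<Rightarrow> 'a set" where "verts G \<equiv> fst G"
abbreviation edges :: "'a graph \<Rightarrow> 'a set set" where "edges G \<equiv> snd G"

definition is_graph :: "'a graph \<Rightarrow> bool" where
  "is_graph G \<longleftrightarrow> finite (verts G) \<and> (\<forall>e\<in>edges G. e \<subseteq> verts G \<and> card e = 2)"

definition vdegree :: "'a graph \<Rightarrow> 'a \<Rightarrow> nat" where
  "vdegree G v = card {e \<in> edges G. v \<in> e}"

definition leaves :: "'a graph \<Rightarrow> 'a set" where
  "leaves G = {v \<in> verts G. vdegree G v = 1}"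

definition internal_verts :: "'a graph \<Rightarrow> 'a set" where
  "internal_verts G = verts G - leaves G"

definition unbounded_edges :: "'a graph \<Rightarrow> 'a set set" where
  "unbounded_edges G = {e \<in> edges G. e \<inter> leaves G \<noteq> {}}"

definition bounded_edges :: "'a graph \<Rightarrow> 'a set set" where
  "bounded_edges G = edges G - unbounded_edges G"

definition trivalent :: "'a graph \<Rightarrow> bool" where
  "trivalent G \<longleftrightarrow> (\<forall>v\<in>verts G. vdegree G v \<in> {1, 3})"

definition adjacency :: "'a set set \<Rightarrow> ('a \<times> 'a) set" where
  "adjacency S = {(x, y). {x, y} \<in> S}"

definition graph_connected :: "'a graph \<Rightarrow> bool" where
  "graph_connected G \<longleftrightarrow> verts G \<noteq> {} \<and> (\<forall>u\<in>verts G. \<forall>v\<in>verts G. (u, v) \<in> (adjacency (edges G))\<^sup>*)"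

definition is_circuit :: "'a graph \<Rightarrow> 'a list \<Rightarrow> bool" where
  "is_circuit G vs \<longleftrightarrow> length vs \<ge> 3 \<and> distinct vs \<and>
     (\<forall>i<length vs. {vs ! i, vs ! (Suc i mod length vs)} \<in> edges G)"

definition is_tree :: "'a graph \<Rightarrow> bool" where
  "is_tree G \<longleftrightarrow> is_graph G \<and> graph_connected G \<and> (\<nexists>vs. is_circuit G vs)"

text \<open>The edge map of an isomorphism \<open>F\<close> is \<open>(`) F\<close>.\<close>

definition graph_iso :: "'a graph \<Rightarrow> 'b graph \<Rightarrow> ('a \<Rightarrow> 'b) \<Rightarrow> bool" where
  "graph_iso G H F \<longleftrightarrow>
     bij_betw F (verts G) (verts H) \<and> bij_betw ((`) F) (edges G) (edges H)"

text \<open>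
  Degeneration by a set \<open>S\<close> of edges, all contracted at once: the new vertices are the
  connected components of the graph with vertex set \<open>verts G\<close> and edge set \<open>S\<close>, and
  \<open>merge G S v\<close> is the component containing \<open>v\<close>.  For \<open>S = {e}\<close> this is the contraction of
  the single edge \<open>e\<close>.
\<close>

definition merge :: "'a graph \<Rightarrow> 'a set set \<Rightarrow> 'a \<Rightarrow> 'a set" where
  "merge G S v = {w \<in> verts G. (v, w) \<in> (adjacency S)\<^sup>*}"

definition degenerate :: "'a graph \<Rightarrow> 'a set set \<Rightarrow> 'a set graph" where
  "degenerate G S = (merge G S ` verts G, (\<lambda>e. merge G S ` e) ` (edges G - S))"

section \<open>Integer partitions and the class algebra of the symmetric group\<close>

definition int_partition :: "nat \<Rightarrow> nat multiset \<Rightarrow> bool" where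
  "int_partition d \<mu> \<longleftrightarrow> 0 \<notin># \<mu> \<and> sum_mset \<mu> = d"

definition cycle_type :: "nat \<Rightarrow> (nat \<Rightarrow> nat) \<Rightarrow> nat multiset" where
  "cycle_type d g = image_mset card (mset_set (orbit g ` {1..d}))"

text \<open>
  An element \<open>\<Sum>g. c\<^sub>g g\<close> of the real group algebra of a finite group is represented by its
  coefficient function \<open>c\<close>, which vanishes outside the carrier.
\<close>

definition galg_mult ::
  "('g, 'z) monoid_scheme \<Rightarrow> ('g \<Rightarrow> real) \<Rightarrow> ('g \<Rightarrow> real) \<Rightarrow> 'g \<Rightarrow> real" where
  "galg_mult G a b = (\<lambda>g. \<Sum>(x, y)\<in>{(x, y) \<in> carrier G \<times> carrier G. x \<otimes>\<^bsub>G\<^esub> y = g}. a x * b y)"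

definition galg_tr :: "('g, 'z) monoid_scheme \<Rightarrow> ('g \<Rightarrow> real) \<Rightarrow> real" where
  "galg_tr G a = a \<one>\<^bsub>G\<^esub>"

definition class_sum :: "nat \<Rightarrow> nat multiset \<Rightarrow> (nat \<Rightarrow> nat) \<Rightarrow> real" where
  "class_sum d \<mu> = (\<lambda>g. if g \<in> carrier (sym_group d) \<and> cycle_type d g = \<mu> then 1 else 0)"

definition tr3 :: "nat \<Rightarrow> nat multiset \<Rightarrow> nat multiset \<Rightarrow> nat multiset \<Rightarrow> real" where
  "tr3 d \<mu>1 \<mu>2 \<mu>3 = galg_tr (sym_group d)
     (galg_mult (sym_group d) (galg_mult (sym_group d) (class_sum d \<mu>1) (class_sum d \<mu>2))
        (class_sum d \<mu>3))"

section \<open>Labelled trivalent trees and their topological types\<close>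

text \<open>
  \<open>ulab T i\<close> is the unbounded edge labelled \<open>\<lambda>\<^sub>i\<close> (for \<open>i < n\<close>) and \<open>blab T i\<close> the bounded edge
  labelled \<open>e\<^sub>i\<close> (for \<open>i < n - 3\<close>); labels are indexed from 0, and the values of the labelling
  functions at other arguments carry no information.
\<close>

record 'a ltree =
  lgraph :: "'a graph"
  ulab :: "nat \<Rightarrow> 'a set"
  blab :: "nat \<Rightarrow> 'a set"

definition labelled_tree :: "nat \<Rightarrow> 'a ltree \<Rightarrow> bool" where
  "labelled_tree n T \<longleftrightarrow> is_tree (lgraph T) \<and> trivalent (lgraph T) \<and> card (leaves (lgraph T)) = n \<and>
     bij_betw (ulab T) {..<n} (unbounded_edges (lgraph T)) \<and>
     bij_betw (blab T) {..<n - 3} (bounded_edges (lgraph T))"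

definition ltree_iso :: "nat \<Rightarrow> 'a ltree \<Rightarrow> 'b ltree \<Rightarrow> ('a \<Rightarrow> 'b) \<Rightarrow> bool" where
  "ltree_iso n T T' F \<longleftrightarrow> graph_iso (lgraph T) (lgraph T') F \<and>
     (\<forall>i<n. F ` ulab T i = ulab T' i) \<and> (\<forall>i<n - 3. F ` blab T i = blab T' i)"

text \<open>
  Every finite graph is isomorphic to one with vertices in \<open>nat\<close>, so isomorphism classes are
  formed over that vertex type.
\<close>

definition ltree_types :: "nat \<Rightarrow> nat ltree set set" where
  "ltree_types n = {T. labelled_tree n T} //
     {(T, T'). labelled_tree n T \<and> labelled_tree n T' \<and> (\<exists>F. ltree_iso n T T' F)}"

definition edge_partition ::
  "nat \<Rightarrow> (nat \<Rightarrow> nat multiset) \<Rightarrow> (nat \<Rightarrow> nat multiset) \<Rightarrow> 'a ltree \<Rightarrow> 'a set \<Rightarrow> nat multiset" where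
  "edge_partition n \<sigma> \<nu> T e =
     (if e \<in> unbounded_edges (lgraph T) then \<sigma> (the_inv_into {..<n} (ulab T) e)
      else \<nu> (the_inv_into {..<n - 3} (blab T) e))"

definition acceptable_tree ::
  "nat \<Rightarrow> nat \<Rightarrow> (nat \<Rightarrow> nat multiset) \<Rightarrow> (nat \<Rightarrow> nat multiset) \<Rightarrow> 'a ltree \<Rightarrow> bool" where
  "acceptable_tree n d \<sigma> \<nu> T \<longleftrightarrow>
     (\<forall>v\<in>internal_verts (lgraph T). \<forall>a b c. {e \<in> edges (lgraph T). v \<in> e} = {a, b, c} \<longrightarrow>
        tr3 d (edge_partition n \<sigma> \<nu> T a) (edge_partition n \<sigma> \<nu> T b) (edge_partition n \<sigma> \<nu> T c) \<noteq> 0)"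

text \<open>
  The acceptable data: pairs of a topological type of labelled trees and a choice of partitions
  for the bounded edges.  Acceptability does not depend on the representative of the type.
\<close>

definition acceptable ::
  "nat \<Rightarrow> nat \<Rightarrow> (nat \<Rightarrow> nat multiset) \<Rightarrow> (nat ltree set \<times> (nat \<Rightarrow> nat multiset)) set" where
  "acceptable n d \<sigma> = {(X, \<nu>). X \<in> ltree_types n \<and>
     \<nu> \<in> {..<n - 3} \<rightarrow>\<^sub>E {\<mu>. int_partition d \<mu>} \<and> (\<forall>T\<in>X. acceptable_tree n d \<sigma> \<nu> T)}"

section \<open>Metric graphs\<close>

text \<open>
  \<open>surv M\<close> is the set of indices of those labels \<open>e\<^sub>i\<close> that still occur in \<open>M\<close>;
  \<open>mblab M\<close> is meaningful only on \<open>surv M\<close>, and \<open>elen M\<close> only on bounded edges.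
\<close>

record 'a lmetric_graph =
  mgraph :: "'a graph"
  mulab :: "nat \<Rightarrow> 'a set"
  surv :: "nat set"
  mblab :: "nat \<Rightarrow> 'a set"
  elen :: "'a set \<Rightarrow> real"

definition metric_iso :: "'a lmetric_graph \<Rightarrow> 'b lmetric_graph \<Rightarrow> ('a \<Rightarrow> 'b) \<Rightarrow> bool" where
  "metric_iso M N F \<longleftrightarrow> graph_iso (mgraph M) (mgraph N) F \<and>
     (\<forall>e\<in>bounded_edges (mgraph M). elen N (F ` e) = elen M e)"

definition tree_at :: "nat \<Rightarrow> 'a ltree \<Rightarrow> (nat \<Rightarrow> real) \<Rightarrow> 'a set lmetric_graph" where
  "tree_at n T p =
     (let Z = blab T ` {i. i < n - 3 \<and> p i = 0};
          I = {i. i < n - 3 \<and> p i > 0};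
          bl = (\<lambda>i. merge (lgraph T) Z ` blab T i)
      in \<lparr> mgraph = degenerate (lgraph T) Z,
           mulab = (\<lambda>i. merge (lgraph T) Z ` ulab T i),
           surv = I,
           mblab = bl,
           elen = (\<lambda>e. p (the_inv_into I bl e)) \<rparr>)"

section \<open>The space\<close>

definition orthant :: "nat \<Rightarrow> (nat \<Rightarrow> real) topology" where
  "orthant m = subtopology (Euclidean_space m) {p. \<forall>i<m. p i \<ge> 0}"

definition Dspace ::
  "nat \<Rightarrow> nat \<Rightarrow> (nat \<Rightarrow> nat multiset) \<Rightarrow>
   ((nat ltree set \<times> (nat \<Rightarrow> nat multiset)) \<times> (nat \<Rightarrow> real)) topology" where
  "Dspace n d \<sigma> = sum_topology (\<lambda>_. orthant (n - 3)) (acceptable n d \<sigma>)"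

text \<open>
  In \<open>ident\<close>, the choice of representatives \<open>T\<close> and \<open>T'\<close> of the two topological types is
  immaterial, because \<open>tree_at\<close> respects isomorphisms of labelled trees.
\<close>

definition ident ::
  "nat \<Rightarrow> nat \<Rightarrow> (nat \<Rightarrow> nat multiset) \<Rightarrow>
   (((nat ltree set \<times> (nat \<Rightarrow> nat multiset)) \<times> (nat \<Rightarrow> real)) \<times>
    ((nat ltree set \<times> (nat \<Rightarrow> nat multiset)) \<times> (nat \<Rightarrow> real))) set" where
  "ident n d \<sigma> = {(((X, \<nu>), p), ((X', \<nu>'), q)).
     ((X, \<nu>), p) \<in> topspace (Dspace n d \<sigma>) \<and> ((X', \<nu>'), q) \<in> topspace (Dspace n d \<sigma>) \<and>
     (\<exists>T\<in>X. \<exists>T'\<in>X'. \<exists>F. metric_iso (tree_at n T p) (tree_at n T' q) F \<and>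
        (\<forall>i<n. F ` mulab (tree_at n T p) i = mulab (tree_at n T' q) i) \<and>
        (\<forall>i\<in>surv (tree_at n T p). \<forall>j\<in>surv (tree_at n T' q).
           F ` mblab (tree_at n T p) i = mblab (tree_at n T' q) j \<longrightarrow> \<nu> i = \<nu>' j))}"

definition quotient_topology :: "'a topology \<Rightarrow> ('a \<times> 'a) set \<Rightarrow> 'a set topology" where
  "quotient_topology X R = topology (\<lambda>U. U \<subseteq> topspace X // R \<and>
     openin X {x \<in> topspace X. R `` {x} \<in> U})"

lemma openin_quotient_topology:
  "openin (quotient_topology X R) U \<longleftrightarrow>
     U \<subseteq> topspace X // R \<and> openin X {x \<in> topspace X. R `` {x} \<in> U}"
proof -
  have 1: "{x \<in> topspace X. R `` {x} \<in> S \<inter> T} =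
      {x \<in> topspace X. R `` {x} \<in> S} \<inter> {x \<in> topspace X. R `` {x} \<in> T}" for S T by auto
  have 2: "{x \<in> topspace X. R `` {x} \<in> \<Union> K} =
      (\<Union>S\<in>K. {x \<in> topspace X. R `` {x} \<in> S})" for K by auto
  have "istopology (\<lambda>U. U \<subseteq> topspace X // R \<and> openin X {x \<in> topspace X. R `` {x} \<in> U})"
    unfolding istopology_def 1 2 by (auto simp only: intro!: openin_Union openin_Int)
  then show ?thesis
    by (simp add: quotient_topology_def)
qed

lemma topspace_quotient_topology: "topspace (quotient_topology X R) = topspace X // R"
proof -
  have "{x \<in> topspace X. R `` {x} \<in> topspace X // R} = topspace X"
    by (auto simp: quotient_def)
  then have "openin (quotient_topology X R) (topspace X // R)"
    by (simp add: openin_quotient_topology)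
  then show ?thesis
    by (metis openin_quotient_topology openin_subset openin_topspace subset_antisym)
qed

lemma quotient_map_quotient_topology:
  "quotient_map X (quotient_topology X R) (\<lambda>x. R `` {x})"
  by (auto simp: quotient_map_def topspace_quotient_topology openin_quotient_topology quotient_def)

definition Hspace ::
  "nat \<Rightarrow> nat \<Rightarrow> (nat \<Rightarrow> nat multiset) \<Rightarrow>
   ((nat ltree set \<times> (nat \<Rightarrow> nat multiset)) \<times> (nat \<Rightarrow> real)) set topology" where
  "Hspace n d \<sigma> = quotient_topology (Dspace n d \<sigma>) (ident n d \<sigma>)"

end

theory Submission
  imports Defs
begin

text \<open>
  Every orthant contains the origin, where all bounded edges of the tree are contracted.  A tree
  with all its bounded edges contracted is a star whose rays are labelled by the \<open>\<lambda>\<^sub>i\<close>, and no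
  label \<open>e\<^sub>i\<close> survives, so the origins of all the orthants are identified.  Hence the quotient is
  a union of connected sets with a common point.
\<close>

section \<open>Stars with labelled rays\<close>

text \<open>The function \<open>f\<close> of tips and the centre \<open>c\<close> carry the
  labelling along: the ray with label \<open>i\<close> is \<open>{f i, c}\<close>.\<close>

definition star :: "nat \<Rightarrow> (nat \<Rightarrow> 'a) \<Rightarrow> 'a \<Rightarrow> 'a graph" where
  "star n f c = (insert c (f ` {..<n}), (\<lambda>i. {f i, c}) ` {..<n})"

text \<open>Each tip \<open>f i\<close> lies on its own ray only, so it is a leaf and every ray is
  unbounded. This makes the length condition of \<open>metric_iso\<close> vacuous for stars.\<close>

lemma bounded_edges_star:
  assumes "inj_on f {..<n}" and "c \<notin> f ` {..<n}"
  shows "bounded_edges (star n f c) = {}"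
proof -
  have "f i \<in> leaves (star n f c)" if "i < n" for i
  proof -
    have "{e \<in> edges (star n f c). f i \<in> e} = {{f i, c}}"
      using assms that by (auto simp: star_def inj_on_def)
    then show ?thesis
      using that by (simp add: leaves_def vdegree_def) (simp add: star_def)
  qed
  then show ?thesis
    by (auto simp: bounded_edges_def unbounded_edges_def) (auto simp: star_def)
qed

text \<open>Centre goes to centre and the tip with label \<open>i\<close> to the tip with label
  \<open>i\<close>; this respects the labels of the rays by construction.\<close>

lemma star_iso:
  assumes f: "inj_on f {..<n}" "c \<notin> f ` {..<n}" and g: "inj_on g {..<n}" "b \<notin> g ` {..<n}"
  obtains F where "graph_iso (star n f c) (star n g b) F" and "\<And>i. i < n \<Longrightarrow> F ` {f i, c} = {g i, b}"
proof
  \<comment> \<open>The inverse of \<open>f\<close> reads off the label of a tip. The centre is no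
    tip and needs its own case.\<close>
  define F where "F x = (if x = c then b else g (the_inv_into {..<n} f x))" for x
  have Fc: "F c = b" by (simp add: F_def)
  have Ff: "F (f i) = g i" if "i < n" for i
    using f that by (auto simp: F_def the_inv_into_f_f)
  show *: "F ` {f i, c} = {g i, b}" if "i < n" for i
    using that by (simp add: Fc Ff)
  have "F ` f ` {..<n} = g ` {..<n}"
    using Ff by (auto simp: image_image)
  moreover have "inj_on F (insert c (f ` {..<n}))"
    using g f by (auto simp: inj_on_def Ff Fc)
  moreover have "(`) F ` (\<lambda>i. {f i, c}) ` {..<n} = (\<lambda>i. {g i, b}) ` {..<n}"
    unfolding image_image by (rule image_cong) (simp_all add: Fc Ff)
  moreover have "inj_on ((`) F) ((\<lambda>i. {f i, c}) ` {..<n})"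
    using g by (auto simp: inj_on_def Ff Fc doubleton_eq_iff)
  ultimately show "graph_iso (star n f c) (star n g b) F"
    by (simp add: graph_iso_def star_def bij_betw_def Fc)
qed

lemma graph_iso_comp:
  assumes "graph_iso G H F" and "graph_iso H K F'"
  shows "graph_iso G K (F' \<circ> F)"
proof -
  have "(`) (F' \<circ> F) = (`) F' \<circ> (`) F"
    by (auto simp: image_comp)
  with assms show ?thesis
    by (auto simp: graph_iso_def intro: bij_betw_trans)
qed

section \<open>Contraction of all bounded edges\<close>

lemma leaf_edge_unique:
  assumes "v \<in> leaves G" "e \<in> edges G" "v \<in> e" "e' \<in> edges G" "v \<in> e'"
  shows "e = e'"
proof -
  from assms(1) obtain a where a: "{e \<in> edges G. v \<in> e} = {a}"
    by (auto simp: leaves_def vdegree_def card_1_singleton_iff)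
  have "e \<in> {a}" "e' \<in> {a}"
    unfolding a[symmetric] using assms(2-) by simp_all
  then show ?thesis
    by simp
qed

lemma bounded_edge_no_leaf:
  assumes "{v, w} \<in> bounded_edges G"
  shows "v \<notin> leaves G" and "w \<notin> leaves G"
  using assms by (auto simp: bounded_edges_def unbounded_edges_def)

text \<open>No bounded edge contains a leaf, so a path of bounded edges starting at a leaf has no
  first step.\<close>

lemma merge_bounded_leaf:
  assumes "v \<in> leaves G"
  shows "merge G (bounded_edges G) v = {v}"
proof -
  have "w = v" if "(v, w) \<in> (adjacency (bounded_edges G))\<^sup>*" for w
    using that
  proof (cases rule: converse_rtranclE)
    case (step y)
    with assms show ?thesis
      using bounded_edge_no_leaf(1) by (fastforce simp: adjacency_def)
  qed simp
  moreover have "v \<in> verts G" using assms by (simp add: leaves_def)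
  ultimately show ?thesis
    by (auto simp: merge_def)
qed

text \<open>Paths of bounded edges never end in a leaf when they start outside the leaves.
  Conversely, a walk in \<open>G\<close> between internal vertices uses bounded edges only, apart
  from detours into leaves, which can be cut out.\<close>

lemma merge_bounded_internal:
  assumes G: "is_graph G" "graph_connected G" and v: "v \<in> internal_verts G"
  shows "merge G (bounded_edges G) v = internal_verts G"
proof -
  let ?A = "(adjacency (bounded_edges G))\<^sup>*"
  have edge: "x \<in> verts G" "y \<in> verts G" if "{x, y} \<in> edges G" for x y
    using G(1) that by (auto simp: is_graph_def)
  txt \<open>A walk from \<open>v\<close> that enters a leaf has to return to the vertex it came from.\<close>
  have walk: "(w \<in> internal_verts G \<longrightarrow> (v, w) \<in> ?A) \<and>
      (w \<in> leaves G \<longrightarrow> (\<forall>u. {w, u} \<in> edges G \<longrightarrow> u \<in> internal_verts G \<and> (v, u) \<in> ?A))"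
    if "(v, w) \<in> (adjacency (edges G))\<^sup>*" for w
    using that
  proof (induction rule: rtrancl_induct)
    case base
    with v show ?case by (simp add: internal_verts_def)
  next
    case (step y z)
    from step.hyps have yz: "{y, z} \<in> edges G" by (simp add: adjacency_def)
    show ?case
    proof (cases "y \<in> leaves G")
      case True
      with step.IH yz show ?thesis by (simp add: internal_verts_def)
    next
      case False
      with edge[OF yz] have y: "y \<in> internal_verts G" by (simp add: internal_verts_def)
      with step.IH have vy: "(v, y) \<in> ?A" by simp
      have "(v, z) \<in> ?A" if "z \<in> internal_verts G"
      proof -
        have "{y, z} \<in> bounded_edges G"
          using y that yz by (auto simp: bounded_edges_def unbounded_edges_def internal_verts_def)
        with vy show ?thesis
          by (auto simp: adjacency_def intro: rtrancl_into_rtrancl)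
      qed
      \<comment> \<open>The leaf \<open>z\<close> has a single edge, the one just walked along, so
        its only neighbour is \<open>y\<close>.\<close>
      moreover have "u = y" if "z \<in> leaves G" "{z, u} \<in> edges G" for u
        using leaf_edge_unique[OF that _ yz] by (auto simp: doubleton_eq_iff)
      ultimately show ?thesis using y vy by blast
    qed
  qed
  have "w \<in> internal_verts G" if "(v, w) \<in> ?A" "w \<in> verts G" for w
    using that(1)
  proof (cases rule: rtranclE)
    case base
    with v show ?thesis by simp
  next
    case (step y)
    then have "w \<notin> leaves G"
      using bounded_edge_no_leaf(2)[of y w G] by (simp add: adjacency_def)
    with that show ?thesis by (simp add: internal_verts_def)
  qed
  moreover have "(v, w) \<in> ?A" if "w \<in> internal_verts G" for w
    using that v walk G(2) by (auto simp: graph_connected_def internal_verts_def)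
  ultimately show ?thesis
    by (auto simp: merge_def internal_verts_def)
qed

text \<open>
  There are as many unbounded edges as leaves and every unbounded edge contains a leaf, so it
  contains only one.
\<close>

lemma unbounded_edge_leaf_unique:
  assumes G: "is_graph G" and card: "card (unbounded_edges G) = card (leaves G)"
    and e: "e \<in> unbounded_edges G" "v \<in> e" "w \<in> e" "v \<in> leaves G" "w \<in> leaves G"
  shows "v = w"
proof -
  have "\<exists>e. e \<in> edges G \<and> x \<in> e" if "x \<in> leaves G" for x
    using that by (auto simp: leaves_def vdegree_def card_1_singleton_iff)
  then obtain h where h: "x \<in> leaves G \<Longrightarrow> h x \<in> edges G \<and> x \<in> h x" for x
    by metis
  have h_eq: "h x = e" if "x \<in> leaves G" "e \<in> edges G" "x \<in> e" for x e
    using that h leaf_edge_unique by metis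
  have "h ` leaves G = unbounded_edges G"
  proof
    show "h ` leaves G \<subseteq> unbounded_edges G"
      using h by (auto simp: unbounded_edges_def)
    show "unbounded_edges G \<subseteq> h ` leaves G"
    proof
      fix e assume "e \<in> unbounded_edges G"
      then obtain x where "x \<in> leaves G" "e \<in> edges G" "x \<in> e"
        by (auto simp: unbounded_edges_def)
      with h_eq[of x e] show "e \<in> h ` leaves G" by blast
    qed
  qed
  moreover have "finite (leaves G)"
    using G by (simp add: is_graph_def leaves_def)
  \<comment> \<open>A surjection between finite sets of equal size is injective.\<close>
  ultimately have "inj_on h (leaves G)"
    using card by (intro eq_card_imp_inj_on) auto
  moreover have "h v = h w"
    using e h_eq by (auto simp: unbounded_edges_def)
  ultimately show ?thesis
    using e by (auto dest: inj_onD)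
qed

text \<open>All internal vertices merge into the centre, while each leaf stays alone. In the
  contracted graph the tips are therefore singletons of leaves and the centre is the set
  \<open>internal_verts\<close> of the tree.\<close>

lemma degenerate_bounded_star:
  assumes T: "labelled_tree n T" and n: "n > 0"
  obtains f c where "inj_on f {..<n}" and "c \<notin> f ` {..<n}"
    and "degenerate (lgraph T) (bounded_edges (lgraph T)) = star n f c"
    and "\<And>i. i < n \<Longrightarrow> merge (lgraph T) (bounded_edges (lgraph T)) ` ulab T i = {f i, c}"
proof -
  define G where "G = lgraph T"
  define M where "M = merge G (bounded_edges G)"
  have G: "is_graph G" "graph_connected G"
    and bij: "bij_betw (ulab T) {..<n} (unbounded_edges G)" and card: "card (leaves G) = n"
    using T by (auto simp: labelled_tree_def is_tree_def G_def)
  \<comment> \<open>Both numbers equal the number of labels. This excludes the tree with a single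
    edge, where two leaves share one unbounded edge.\<close>
  have card': "card (unbounded_edges G) = card (leaves G)"
    using bij_betw_same_card[OF bij] card by simp
  have ub: "ulab T i \<in> unbounded_edges G" if "i < n" for i
    using bij that by (auto simp: bij_betw_def)
  have "\<exists>x y. ulab T i = {x, y} \<and> x \<in> leaves G \<and> y \<in> internal_verts G" if "i < n" for i
  proof -
    from ub[OF that] obtain x where x: "x \<in> ulab T i" "x \<in> leaves G"
      by (auto simp: unbounded_edges_def)
    from ub[OF that] G have "card (ulab T i) = 2" and sub: "ulab T i \<subseteq> verts G"
      by (auto simp: is_graph_def unbounded_edges_def)
    then obtain a b where "ulab T i = {a, b}" "a \<noteq> b"
      by (auto simp: card_2_iff)
    with x have "\<exists>y. ulab T i = {x, y} \<and> y \<noteq> x"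
      by (auto simp: doubleton_eq_iff)
    then obtain y where y: "ulab T i = {x, y}" "y \<noteq> x"
      by blast
    with unbounded_edge_leaf_unique[OF G(1) card' ub[OF that], of x y] x have "y \<notin> leaves G"
      by blast
    with x y sub show ?thesis
      by (auto simp: internal_verts_def)
  qed
  \<comment> \<open>The two ends of the edge with label \<open>i\<close> are chosen in turn: first
    its leaf \<open>l i\<close>, then its internal vertex \<open>k i\<close>.\<close>
  then have "\<forall>i\<in>{..<n}. \<exists>x. x \<in> leaves G \<and> (\<exists>y. ulab T i = {x, y} \<and> y \<in> internal_verts G)"
    by blast
  from bchoice[OF this] obtain l where l: "\<forall>i\<in>{..<n}. l i \<in> leaves G \<and>
      (\<exists>y. ulab T i = {l i, y} \<and> y \<in> internal_verts G)" ..
  then have "\<forall>i\<in>{..<n}. \<exists>y. ulab T i = {l i, y} \<and> y \<in> internal_verts G"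
    by blast
  from bchoice[OF this] obtain k
    where "\<forall>i\<in>{..<n}. ulab T i = {l i, k i} \<and> k i \<in> internal_verts G" ..
  with l have lk: "ulab T i = {l i, k i}" "l i \<in> leaves G" "k i \<in> internal_verts G"
    if "i < n" for i
    using that by simp_all
  have M_leaf: "M x = {x}" if "x \<in> leaves G" for x
    using merge_bounded_leaf that by (simp add: M_def)
  have M_internal: "M x = internal_verts G" if "x \<in> internal_verts G" for x
    using merge_bounded_internal G that by (simp add: M_def)
  have inj: "inj_on l {..<n}"
  proof (rule inj_onI)
    fix i j assume ij: "i \<in> {..<n}" "j \<in> {..<n}" "l i = l j"
    then have "l i \<in> leaves G" "l i \<in> ulab T i" "l i \<in> ulab T j"
      using lk(1)[of i] lk(1)[of j] lk(2)[of i] by auto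
    moreover have "ulab T i \<in> edges G" "ulab T j \<in> edges G"
      using ub ij by (auto simp: unbounded_edges_def)
    ultimately have "ulab T i = ulab T j"
      by (metis leaf_edge_unique)
    with bij ij show "i = j"
      by (auto simp: bij_betw_def dest: inj_onD)
  qed
  have "finite (leaves G)"
    using G by (simp add: is_graph_def leaves_def)
  \<comment> \<open>An injection of the \<open>n\<close> labels into the \<open>n\<close> leaves
    reaches every leaf.\<close>
  then have l_leaves: "l ` {..<n} = leaves G"
    using inj lk card by (intro card_subset_eq) (auto simp: card_image)
  have verts: "verts G = l ` {..<n} \<union> internal_verts G"
    by (auto simp: l_leaves internal_verts_def leaves_def)
  \<comment> \<open>The hypothesis \<open>n > 0\<close> enters here: some internal vertex exists, so
    the centre really occurs among the merged vertices.\<close>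
  have "k 0 \<in> internal_verts G" using lk n by simp
  then have "M ` internal_verts G = {internal_verts G}"
    using M_internal by auto
  moreover have "M ` l ` {..<n} = (\<lambda>i. {l i}) ` {..<n}"
    unfolding image_image using M_leaf lk by (intro image_cong) auto
  ultimately have 1: "M ` verts G = insert (internal_verts G) ((\<lambda>i. {l i}) ` {..<n})"
    by (simp add: verts image_Un)
  have 2: "M ` ulab T i = {{l i}, internal_verts G}" if "i < n" for i
    using lk[OF that] by (simp add: M_leaf M_internal)
  have "edges G - bounded_edges G = ulab T ` {..<n}"
    using bij by (auto simp: bij_betw_def bounded_edges_def unbounded_edges_def)
  then have 3: "(\<lambda>e. M ` e) ` (edges G - bounded_edges G) = (\<lambda>i. {{l i}, internal_verts G}) ` {..<n}"
    unfolding image_image by (auto simp: 2 image_image)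
  show ?thesis
  proof
    show "inj_on (\<lambda>i. {l i}) {..<n}" using inj by (auto simp: inj_on_def)
    show "internal_verts G \<notin> (\<lambda>i. {l i}) ` {..<n}"
      using lk(2) by (fastforce simp: internal_verts_def)
    show "degenerate (lgraph T) (bounded_edges (lgraph T)) = star n (\<lambda>i. {l i}) (internal_verts G)"
      using 1 3 by (simp add: degenerate_def star_def M_def G_def)
    show "merge (lgraph T) (bounded_edges (lgraph T)) ` ulab T i = {{l i}, internal_verts G}"
      if "i < n" for i
      using 2[OF that] by (simp add: M_def G_def)
  qed
qed

section \<open>Trees at the origin of an orthant\<close>

text \<open>With all lengths zero, the contracted set in \<open>tree_at\<close> consists of all
  bounded edges and no index has positive length.\<close>

lemma tree_at_origin:
  assumes T: "labelled_tree n T" and n: "n > 0"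
  obtains f c where "inj_on f {..<n}" and "c \<notin> f ` {..<n}"
    and "mgraph (tree_at n T (\<lambda>_. 0)) = star n f c"
    and "\<And>i. i < n \<Longrightarrow> mulab (tree_at n T (\<lambda>_. 0)) i = {f i, c}"
    and "surv (tree_at n T (\<lambda>_. 0)) = {}"
proof -
  have "blab T ` {i. i < n - 3} = bounded_edges (lgraph T)"
    using T by (simp add: labelled_tree_def bij_betw_def lessThan_def)
  moreover obtain f c where "inj_on f {..<n}" and "c \<notin> f ` {..<n}"
    and "degenerate (lgraph T) (bounded_edges (lgraph T)) = star n f c"
    and "\<And>i. i < n \<Longrightarrow> merge (lgraph T) (bounded_edges (lgraph T)) ` ulab T i = {f i, c}"
    using degenerate_bounded_star[OF T n] by blast
  ultimately show ?thesis
    by (intro that[of f c]) (simp_all add: tree_at_def Let_def)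
qed

lemma ltree_types_labelled:
  assumes "X \<in> ltree_types n" and "T \<in> X"
  shows "labelled_tree n T"
  using assms by (auto simp: ltree_types_def quotient_def)

text \<open>Reflexivity, witnessed by \<open>id\<close>, puts a tree into its own class. Membership
  in \<open>ident\<close> asks for representatives, so they must exist.\<close>

lemma ltree_types_nonempty:
  assumes "X \<in> ltree_types n"
  obtains T where "T \<in> X"
proof -
  define R :: "(nat ltree \<times> nat ltree) set" where
    "R = {(T, T'). labelled_tree n T \<and> labelled_tree n T' \<and> (\<exists>F. ltree_iso n T T' F)}"
  from assms obtain T where T: "labelled_tree n T" and X: "X = R `` {T}"
    unfolding ltree_types_def R_def[symmetric] by (auto elim: quotientE)
  have "(`) (id :: nat \<Rightarrow> nat) = id" by auto
  then have "ltree_iso n T T id"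
    by (simp add: ltree_iso_def graph_iso_def)
  with T X have "T \<in> X" by (auto simp: R_def)
  with that show ?thesis .
qed

section \<open>Identification of the origins\<close>

lemma topspace_orthant: "topspace (orthant m) = {p. (\<forall>i\<ge>m. p i = 0) \<and> (\<forall>i<m. p i \<ge> 0)}"
  by (auto simp: orthant_def topspace_Euclidean_space)

lemma topspace_Dspace: "topspace (Dspace n d \<sigma>) = acceptable n d \<sigma> \<times> topspace (orthant (n - 3))"
  by (simp add: Dspace_def)

lemma origin_in_orthant: "(\<lambda>_. 0) \<in> topspace (orthant m)"
  by (simp add: topspace_orthant)

text \<open>An isomorphism \<open>F\<close> from the star at one origin to a third point is
  precomposed with an isomorphism \<open>H\<close> of stars coming from the other origin.
  Interchanging the two origins gives the reverse inclusion, hence equal points of the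
  quotient.\<close>

lemma ident_origin_subset:
  assumes n: "n > 0" and a: "(X, \<nu>) \<in> acceptable n d \<sigma>" and b: "(Y, \<rho>) \<in> acceptable n d \<sigma>"
  shows "ident n d \<sigma> `` {((X, \<nu>), \<lambda>_. 0)} \<subseteq> ident n d \<sigma> `` {((Y, \<rho>), \<lambda>_. 0)}"
proof
  fix z assume "z \<in> ident n d \<sigma> `` {((X, \<nu>), \<lambda>_. 0)}"
  moreover obtain Z \<tau> q where z_eq: "z = ((Z, \<tau>), q)"
    by (metis surj_pair)
  ultimately obtain T T' F where z: "((Z, \<tau>), q) \<in> topspace (Dspace n d \<sigma>)"
    and T: "T \<in> X" and T': "T' \<in> Z"
    and F: "graph_iso (mgraph (tree_at n T (\<lambda>_. 0))) (mgraph (tree_at n T' q)) F"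
    and F_lab: "\<And>i. i < n \<Longrightarrow> F ` mulab (tree_at n T (\<lambda>_. 0)) i = mulab (tree_at n T' q) i"
    by (auto simp: ident_def metric_iso_def)
  from b obtain S where S: "S \<in> Y"
    by (auto simp: acceptable_def elim: ltree_types_nonempty)
  have "labelled_tree n T"
    using a T by (auto simp: acceptable_def intro: ltree_types_labelled)
  then obtain f c where f: "inj_on f {..<n}" "c \<notin> f ` {..<n}"
    and fT: "mgraph (tree_at n T (\<lambda>_. 0)) = star n f c"
      "\<And>i. i < n \<Longrightarrow> mulab (tree_at n T (\<lambda>_. 0)) i = {f i, c}"
    using tree_at_origin[OF _ n] by metis
  have "labelled_tree n S"
    using b S by (auto simp: acceptable_def intro: ltree_types_labelled)
  then obtain g k where g: "inj_on g {..<n}" "k \<notin> g ` {..<n}"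
    and gS: "mgraph (tree_at n S (\<lambda>_. 0)) = star n g k"
      "\<And>i. i < n \<Longrightarrow> mulab (tree_at n S (\<lambda>_. 0)) i = {g i, k}"
    and surv: "surv (tree_at n S (\<lambda>_. 0)) = {}"
    using tree_at_origin[OF _ n] by metis
  obtain H where H: "graph_iso (star n g k) (star n f c) H"
    and H_lab: "\<And>i. i < n \<Longrightarrow> H ` {g i, k} = {f i, c}"
    using star_iso[OF g f] by metis
  \<comment> \<open>The star has no bounded edges, so there are no lengths to compare.\<close>
  have "metric_iso (tree_at n S (\<lambda>_. 0)) (tree_at n T' q) (F \<circ> H)"
    using graph_iso_comp[OF H] F by (simp add: metric_iso_def fT gS bounded_edges_star[OF g])
  moreover have "(F \<circ> H) ` mulab (tree_at n S (\<lambda>_. 0)) i = mulab (tree_at n T' q) i" if "i < n" for i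
    using F_lab[OF that] by (simp only: image_comp[symmetric] gS(2) H_lab fT(2) that)
  moreover have "((Y, \<rho>), \<lambda>_. 0) \<in> topspace (Dspace n d \<sigma>)"
    using b by (simp add: topspace_Dspace origin_in_orthant)
  \<comment> \<open>Since \<open>surv\<close> is empty at the origin, the condition comparing
    partitions on surviving edges holds vacuously.\<close>
  ultimately have "(((Y, \<rho>), \<lambda>_. 0), ((Z, \<tau>), q)) \<in> ident n d \<sigma>"
    unfolding ident_def mem_Collect_eq case_prod_conv using z S T' surv
    by (intro conjI bexI[of _ S] bexI[of _ T'] exI[of _ "F \<circ> H"]) simp_all
  then show "z \<in> ident n d \<sigma> `` {((Y, \<rho>), \<lambda>_. 0)}"
    by (simp add: z_eq)
qed

section \<open>Connectedness\<close>

text \<open>The orthant is a continuous image of a product of real lines, which is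
  connected.\<close>

lemma connected_space_orthant: "connected_space (orthant m)"
proof -
  \<comment> \<open>Absolute values in the first \<open>m\<close> coordinates and zeros elsewhere:
    \<open>?r\<close> maps onto the orthant because it fixes each of its points.\<close>
  let ?r = "\<lambda>p::nat \<Rightarrow> real. \<lambda>i. if i < m then \<bar>p i\<bar> else 0"
  have connected_real: "connected_space euclideanreal"
    using connectedin_topspace[of euclideanreal] by simp
  have "continuous_map (powertop_real UNIV) euclideanreal (\<lambda>p. ?r p i)" for i
    by (cases "i < m") (auto intro!: continuous_map_real_abs continuous_map_product_projection)
  then have "continuous_map (powertop_real UNIV) (powertop_real UNIV) ?r"
    by (simp add: continuous_map_componentwise_UNIV)
  then have "connectedin (powertop_real UNIV) (?r ` topspace (powertop_real UNIV))"
    by (rule connectedin_continuous_map_image)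
      (use connected_real in \<open>simp only: connectedin_topspace connected_space_product_topology\<close>, simp)
  moreover have "p \<in> range ?r" if "p \<in> topspace (orthant m)" for p
    using that by (intro image_eqI[of _ _ p]) (auto simp: topspace_orthant)
  then have "?r ` topspace (powertop_real UNIV) = topspace (orthant m)"
    by (auto simp: topspace_orthant)
  \<comment> \<open>\<open>Euclidean_space m\<close> is itself a subspace of
    \<open>powertop_real UNIV\<close>, so the nested subspace topologies collapse to one.\<close>
  moreover have "orthant m = subtopology (powertop_real UNIV) (topspace (orthant m))"
    by (simp add: topspace_orthant)
       (simp add: orthant_def Euclidean_space_def subtopology_subtopology Int_def)
  ultimately show ?thesis
    by (metis connectedin_def)
qed

theorem theorem3p12:
  fixes n d :: nat and \<sigma> :: "nat \<Rightarrow> nat multiset"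
  assumes "n \<ge> 3" and "d \<ge> 1" and "\<And>i. i < n \<Longrightarrow> int_partition d (\<sigma> i)"
  shows "connected_space (Hspace n d \<sigma>)"
proof -
  let ?\<pi> = "\<lambda>x. ident n d \<sigma> `` {x}"
  let ?O = "topspace (orthant (n - 3))"
  let ?A = "acceptable n d \<sigma>"
  \<comment> \<open>\<open>C a\<close> is the image in the quotient of the orthant indexed by
    \<open>a\<close>.\<close>
  define C where "C = (\<lambda>a. ?\<pi> ` Pair a ` ?O)"
  have quot: "quotient_map (Dspace n d \<sigma>) (Hspace n d \<sigma>) ?\<pi>"
    unfolding Hspace_def by (rule quotient_map_quotient_topology)
  have conn: "connectedin (Hspace n d \<sigma>) (C a)" if "a \<in> ?A" for a
  proof -
    have "continuous_map (orthant (n - 3)) (Dspace n d \<sigma>) (Pair a)"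
      unfolding Dspace_def using that by (rule continuous_map_component_injection)
    then have "connectedin (Dspace n d \<sigma>) (Pair a ` ?O)"
      by (rule connectedin_continuous_map_image)
        (simp add: connectedin_topspace connected_space_orthant)
    then show ?thesis
      unfolding C_def by (rule connectedin_continuous_map_image[OF quotient_imp_continuous_map[OF quot]])
  qed
  have origin: "?\<pi> (a, \<lambda>_. 0) = ?\<pi> (b, \<lambda>_. 0)" if "a \<in> ?A" "b \<in> ?A" for a b
  proof (cases a, cases b)
    fix X \<nu> Y \<rho> assume "a = (X, \<nu>)" "b = (Y, \<rho>)"
    with that \<open>n \<ge> 3\<close> show ?thesis
      by (simp only:) (intro subset_antisym ident_origin_subset; simp)
  qed
  have top: "topspace (Hspace n d \<sigma>) = \<Union> (C ` ?A)"
  proof -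
    have "?A \<times> ?O = (\<Union>a\<in>?A. Pair a ` ?O)" by auto
    then show ?thesis
      using quotient_imp_surjective_map[OF quot, symmetric] by (simp only: topspace_Dspace C_def image_UN)
  qed
  have "connectedin (Hspace n d \<sigma>) (\<Union> (C ` ?A))"
  \<comment> \<open>Without acceptable data the union is empty, and the empty set counts as
    connected. Otherwise the common origin lies in every \<open>C b\<close>.\<close>
  proof (cases "?A = {}")
    case False
    then obtain a where "a \<in> ?A" by blast
    then have "?\<pi> (a, \<lambda>_. 0) \<in> C b" if "b \<in> ?A" for b
      using origin that origin_in_orthant unfolding C_def by blast
    then have "\<Inter> (C ` ?A) \<noteq> {}" by blast
    with conn show ?thesis
      by (intro connectedin_Union) auto
  qed simp
  then show ?thesis
    by (simp add: connectedin_topspace flip: top)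
qed

end
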